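(* Let $A$ be compact, let $\Phi$ be lower semicontinuous on the set $A \times \{ 0 \}$, and let the function $\langle \lambda, \cdot \rangle$ be continuous at the origin for any $\lambda \in \Lambda$. Suppose also that $\sigma$ has a valley at zero, and that for any $\lambda \in \mathcal{A}_{loc}(\mathcal{P})$ the function $\mathscr{L}(\cdot, \lambda, r)$ is lower semicontinuous on $A$ for any $r \ge 0$ large enough. Then $\mathcal{A}(\mathcal{P}) = \mathcal{A}_{loc}(\mathcal{P})$.
   Context: Setting. $X$ is a topological space, $A \subset X$ is a nonempty set, $f \colon X \to \mathbb{R} \cup \{+\infty\}$, and $(\mathcal{P})$ denotes the problem of minimizing $f(x)$ subject to $x \in A$. It is assumed that $\{x \in A \mid f(x) < +\infty\} \ne \emptyset$ and that the optimal value $f^* = \inf_{x \in A} f(x)$ is finite. $P$ is a topological vector space of parameters, $\Lambda$ is a vector space of multipliers, and $\langle \cdot, \cdot \rangle \colon \Lambda \times P \to \mathbb{R}$ is a bilinear coupling function. $\Phi \colon X \times P \to \overline{\mathbb{R}} = \mathbb{R} \cup \{\pm\infty\}$ is a fixed dualizing parameterization function for $f$, i.e. $\Phi(x, 0) = f(x)$ for all $x \in X$. $\sigma \colon P \to [0, +\infty]$ is a fixed augmenting function, i.e. $\sigma(0) = 0$ and $\sigma(p) > 0$ for all $p \in P \setminus \{0\}$. The optimal value function is $v(p) = \inf_{x \in A} \Phi(x, p)$, so $v(0) = f^*$. The augmented Lagrangian is $\mathscr{L}(x, \lambda, r) = \inf_{p \in P} ( \Phi(x, p) - \langle \lambda,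 p \rangle + r \sigma(p) )$ for $x \in X$, $\lambda \in \Lambda$, $r \ge 0$. A multiplier $\lambda \in \Lambda$ is an augmented Lagrange multiplier of $(\mathcal{P})$ if there exists $r \ge 0$ such that $v(p) \ge v(0) + \langle \lambda, p \rangle - r \sigma(p)$ for all $p \in P$. The set of all augmented Lagrange multipliers of $(\mathcal{P})$ is denoted $\mathcal{A}(\mathcal{P})$. Let $x^*$ be a locally optimal solution of $(\mathcal{P})$. A multiplier $\lambda \in \Lambda$ is a (local) augmented Lagrange multiplier at $x^*$ if there exists $r_0 \ge 0$ such that for any $r \ge r_0$ the point $x^*$ is a local minimizer of $\mathscr{L}(\cdot, \lambda, r)$ on $A$, and $\mathscr{L}(x^*, \lambda, r) = f(x^* )$. The set of all such $\lambda$ is denoted $\mathcal{A}(x^* )$. Finally, $\mathcal{A}_{loc}(\mathcal{P}) = \bigcap \mathcal{A}(x^* )$, where the intersection is over all globally optimal solutions $x^*$ of $(\mathcal{P})$. $\sigma$ has a valley at zero if for any neighbourhood $U \subset P$ of zero there exists $\delta > 0$ such that $\sigma(p) \ge \delta$ for all $p \in P \setminus U$.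
   Formalization: The formal theorem adds the assumption that for every λ in A_loc(P) and every x in A, L(x, λ, r) is not −∞ for some r ≥ 0; without it the claim fails when the augmented Lagrangian is lower semicontinuous but takes the value −∞. *)

theory Defs
  imports "HOL-Analysis.Analysis"
begin

text \<open>Real topological vector spaces, not assumed Hausdorff.\<close>

class real_topological_vector = real_vector + topological_ab_group_add +
  assumes tendsto_scaleR_Pair:
    "LIM z (nhds c \<times>\<^sub>F nhds x). fst z *\<^sub>R snd z :> nhds (c *\<^sub>R x)"

instance real_normed_vector \<subseteq> real_topological_vector
proof
  fix c :: real and x :: 'a
  show "LIM z (nhds c \<times>\<^sub>F nhds x). fst z *\<^sub>R snd z :> nhds (c *\<^sub>R x)"
    by (intro tendsto_scaleR filterlim_fst filterlim_snd)
qed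

text \<open>Lower semicontinuity at \<open>x\<close> of the restriction of \<open>g\<close> to \<open>S\<close>, for \<open>x \<in> S\<close>;
  \<open>S = UNIV\<close> gives lower semicontinuity at \<open>x\<close>.\<close>

definition lsc_at_within :: "('a::topological_space \<Rightarrow> ereal) \<Rightarrow> 'a \<Rightarrow> 'a set \<Rightarrow> bool" where
  "lsc_at_within g x S \<longleftrightarrow> (\<forall>c. c < g x \<longrightarrow> (\<exists>U. open U \<and> x \<in> U \<and> (\<forall>y\<in>U \<inter> S. c < g y)))"

definition global_minimizer_on :: "('a \<Rightarrow> ereal) \<Rightarrow> 'a set \<Rightarrow> 'a \<Rightarrow> bool" where
  "global_minimizer_on g S x \<longleftrightarrow> x \<in> S \<and> (\<forall>y\<in>S. g x \<le> g y)"

definition local_minimizer_on :: "('a::topological_space \<Rightarrow> ereal) \<Rightarrow> 'a set \<Rightarrow> 'a \<Rightarrow> bool" where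
  "local_minimizer_on g S x \<longleftrightarrow>
     x \<in> S \<and> (\<exists>U. open U \<and> x \<in> U \<and> (\<forall>y\<in>U \<inter> S. g x \<le> g y))"

definition dualizing_parameterization ::
    "('x \<Rightarrow> ereal) \<Rightarrow> ('x \<Rightarrow> 'p::zero \<Rightarrow> ereal) \<Rightarrow> bool" where
  "dualizing_parameterization f \<Phi> \<longleftrightarrow> (\<forall>x. \<Phi> x 0 = f x)"

definition augmenting_function :: "('p::zero \<Rightarrow> ereal) \<Rightarrow> bool" where
  "augmenting_function \<sigma> \<longleftrightarrow> \<sigma> 0 = 0 \<and> (\<forall>p. p \<noteq> 0 \<longrightarrow> 0 < \<sigma> p)"

definition valley_at_zero :: "('p::{zero,topological_space} \<Rightarrow> ereal) \<Rightarrow> bool" where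
  "valley_at_zero \<sigma> \<longleftrightarrow>
     (\<forall>U. open U \<and> 0 \<in> U \<longrightarrow> (\<exists>\<delta>::real. 0 < \<delta> \<and> (\<forall>p. p \<notin> U \<longrightarrow> ereal \<delta> \<le> \<sigma> p)))"

definition optimal_value_function ::
    "'x set \<Rightarrow> ('x \<Rightarrow> 'p \<Rightarrow> ereal) \<Rightarrow> 'p \<Rightarrow> ereal" where
  "optimal_value_function A \<Phi> p = (INF x\<in>A. \<Phi> x p)"

text \<open>In type \<^typ>\<open>ereal\<close>, \<open>-\<infinity> + \<infinity> = \<infinity>\<close>: parameters with \<open>\<sigma> p = \<infinity>\<close> are inactive in the
  infimum when \<open>r > 0\<close>, in accordance with the inequality defining
  \<open>augmented_multipliers\<close>, whose right-hand side is then \<open>-\<infinity>\<close>.  Moreover \<open>0 * \<infinity> = 0\<close>,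
  which only concerns \<open>r = 0\<close>.\<close>

definition augmented_Lagrangian ::
    "('x \<Rightarrow> 'p \<Rightarrow> ereal) \<Rightarrow> ('l \<Rightarrow> 'p \<Rightarrow> real) \<Rightarrow> ('p \<Rightarrow> ereal) \<Rightarrow> 'x \<Rightarrow> 'l \<Rightarrow> real \<Rightarrow> ereal" where
  "augmented_Lagrangian \<Phi> cpl \<sigma> x \<mu> r =
     (INF p. \<Phi> x p - ereal (cpl \<mu> p) + ereal r * \<sigma> p)"

definition augmented_multipliers ::
    "'x set \<Rightarrow> ('x \<Rightarrow> 'p::zero \<Rightarrow> ereal) \<Rightarrow> ('l \<Rightarrow> 'p \<Rightarrow> real) \<Rightarrow> ('p \<Rightarrow> ereal) \<Rightarrow> 'l set" where
  "augmented_multipliers A \<Phi> cpl \<sigma> =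
     {\<mu>. \<exists>r\<ge>0. \<forall>p. optimal_value_function A \<Phi> p \<ge>
        optimal_value_function A \<Phi> 0 + ereal (cpl \<mu> p) - ereal r * \<sigma> p}"

definition augmented_multipliers_at ::
    "'x::topological_space set \<Rightarrow> ('x \<Rightarrow> ereal) \<Rightarrow> ('x \<Rightarrow> 'p \<Rightarrow> ereal) \<Rightarrow> ('l \<Rightarrow> 'p \<Rightarrow> real) \<Rightarrow>
     ('p \<Rightarrow> ereal) \<Rightarrow> 'x \<Rightarrow> 'l set" where
  "augmented_multipliers_at A f \<Phi> cpl \<sigma> xs =
     {\<mu>. \<exists>r0\<ge>0. \<forall>r\<ge>r0.
        local_minimizer_on (\<lambda>x. augmented_Lagrangian \<Phi> cpl \<sigma> x \<mu> r) A xs \<and>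
        augmented_Lagrangian \<Phi> cpl \<sigma> xs \<mu> r = f xs}"

definition local_augmented_multipliers ::
    "'x::topological_space set \<Rightarrow> ('x \<Rightarrow> ereal) \<Rightarrow> ('x \<Rightarrow> 'p \<Rightarrow> ereal) \<Rightarrow> ('l \<Rightarrow> 'p \<Rightarrow> real) \<Rightarrow>
     ('p \<Rightarrow> ereal) \<Rightarrow> 'l set" where
  "local_augmented_multipliers A f \<Phi> cpl \<sigma> =
     (\<Inter>xs\<in>{x. global_minimizer_on f A x}. augmented_multipliers_at A f \<Phi> cpl \<sigma> xs)"

end

theory Submission
  imports Defs
begin

text \<open>
  Whether \<open>\<mu>\<close> is a multiplier amounts to the bound \<open>f\<^sup>* \<le> \<L>(x, \<mu>, r)\<close> on \<open>A\<close>, for one \<open>r \<ge> 0\<close>.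
  Since \<open>\<L>(x, \<mu>, r)\<close> increases with \<open>r\<close>, compactness of \<open>A\<close> reduces this bound to a neighbourhood
  of each point \<open>x \<in> A\<close>.  At a globally optimal \<open>x\<close> it is the local optimality in the
  definition of a local multiplier.  Elsewhere \<open>f\<^sup>* < f x\<close>; the valley at zero and lower
  semicontinuity of \<open>\<Phi>\<close> at \<open>(x, 0)\<close> push \<open>\<L>(x, \<mu>, r)\<close> above \<open>f\<^sup>*\<close> for large \<open>r\<close>, and lower
  semicontinuity of \<open>\<L>(\<cdot>, \<mu>, r)\<close> spreads this to a neighbourhood.
\<close>

lemma augmenting_function_nonneg: "augmenting_function \<sigma> \<Longrightarrow> 0 \<le> \<sigma> p"
  unfolding augmenting_function_def by (cases "p = 0") (auto intro: less_imp_le)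

lemma augmented_Lagrangian_mono:
  assumes "\<And>p. 0 \<le> \<sigma> p" "r \<le> r'"
  shows "augmented_Lagrangian \<Phi> cpl \<sigma> x \<mu> r \<le> augmented_Lagrangian \<Phi> cpl \<sigma> x \<mu> r'"
  unfolding augmented_Lagrangian_def
  by (intro INF_mono' add_left_mono ereal_mult_right_mono) (use assms in auto)

text \<open>At \<open>p = 0\<close> both the coupling and the penalty vanish, and the infimum lies
  below that term.\<close>

lemma augmented_Lagrangian_le:
  assumes "bilinear cpl" "\<sigma> 0 = 0"
  shows "augmented_Lagrangian \<Phi> cpl \<sigma> x \<mu> r \<le> \<Phi> x 0"
proof -
  have "augmented_Lagrangian \<Phi> cpl \<sigma> x \<mu> r \<le> \<Phi> x 0 - ereal (cpl \<mu> 0) + ereal r * \<sigma> 0"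
    unfolding augmented_Lagrangian_def by (rule INF_lower) simp
  then show ?thesis
    using assms by (simp add: bilinear_rzero zero_ereal_def[symmetric])
qed

text \<open>For finite \<open>s\<close> this is a rearrangement. For \<open>s = \<infinity>\<close>
  and \<open>r > 0\<close> both sides hold: the left term is \<open>-\<infinity>\<close> because
  \<open>w\<close> is finite, and the right one is \<open>\<infinity>\<close> even if
  \<open>a = -\<infinity>\<close>.\<close>

lemma add_le_iff_le_penalized_term:
  assumes "0 \<le> s" "0 \<le> r" "\<bar>w\<bar> \<noteq> \<infinity>"
  shows "w + ereal c - ereal r * s \<le> a \<longleftrightarrow> w \<le> a - ereal c + ereal r * s"
proof (cases s)
  case (real t)
  with assms show ?thesis by (cases a; cases w) auto
next
  case PInf
  with assms show ?thesis
    by (cases "r = 0"; cases a; cases w) (auto simp: zero_ereal_def[symmetric])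
qed (use assms in auto)

text \<open>With the same \<open>r\<close>, both conditions unfold to one family of inequalities
  indexed by \<open>x\<close> and \<open>p\<close>, since each is a lower bound for an infimum, over
  \<open>x\<close> on one side and over \<open>p\<close> on the other.\<close>

lemma augmented_multipliers_iff:
  assumes "\<And>p. 0 \<le> \<sigma> p" "\<bar>optimal_value_function A \<Phi> 0\<bar> \<noteq> \<infinity>"
  shows "\<mu> \<in> augmented_multipliers A \<Phi> cpl \<sigma> \<longleftrightarrow>
    (\<exists>r\<ge>0. \<forall>x\<in>A. optimal_value_function A \<Phi> 0 \<le> augmented_Lagrangian \<Phi> cpl \<sigma> x \<mu> r)"
proof -
  have "(\<forall>p. optimal_value_function A \<Phi> 0 + ereal (cpl \<mu> p) - ereal r * \<sigma> p
          \<le> optimal_value_function A \<Phi> p) \<longleftrightarrow>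
        (\<forall>x\<in>A. optimal_value_function A \<Phi> 0 \<le> augmented_Lagrangian \<Phi> cpl \<sigma> x \<mu> r)"
    if "0 \<le> r" for r
  proof -
    \<comment> \<open>The constant is generalized to \<open>w\<close> so that unfolding
      \<open>optimal_value_function_def\<close> leaves the optimal value itself intact.\<close>
    have *: "(\<forall>p. w + ereal (cpl \<mu> p) - ereal r * \<sigma> p \<le> optimal_value_function A \<Phi> p) \<longleftrightarrow>
        (\<forall>x\<in>A. w \<le> augmented_Lagrangian \<Phi> cpl \<sigma> x \<mu> r)" if "\<bar>w\<bar> \<noteq> \<infinity>" for w
      unfolding optimal_value_function_def augmented_Lagrangian_def le_INF_iff
      using add_le_iff_le_penalized_term[OF assms(1) \<open>0 \<le> r\<close> that] by blast
    show ?thesis using *[OF assms(2)] .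
  qed
  then show ?thesis
    unfolding augmented_multipliers_def by blast
qed

text \<open>Split \<open>r * s\<close> into \<open>r1 * s + (r - r1) * s\<close>: the first part
  together with \<open>a\<close> is at least \<open>m\<close>, the second at least
  \<open>(r - r1) * \<delta>\<close>. Hence \<open>r\<close> does not depend on \<open>a\<close> and
  \<open>s\<close>.\<close>

lemma penalized_term_eventually_ge:
  assumes "0 < \<delta>" "\<bar>m\<bar> \<noteq> \<infinity>" "0 \<le> r1"
  obtains r where "r1 \<le> r"
    "\<And>a s. ereal \<delta> \<le> s \<Longrightarrow> m \<le> a + ereal r1 * s \<Longrightarrow> ereal c \<le> a + ereal r * s"
proof -
  obtain m' where m: "m = ereal m'" using assms by (cases m) auto
  \<comment> \<open>The \<open>max 1\<close> keeps \<open>r\<close> positive even if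
    \<open>r1 = 0\<close>, so that \<open>s = \<infinity>\<close> gives an infinite penalty.\<close>
  define r where "r = r1 + max 1 ((c - m') / \<delta>)"
  show thesis
  proof (rule that)
    show "r1 \<le> r" by (simp add: r_def)
  next
    fix a s assume s: "ereal \<delta> \<le> s" and a: "m \<le> a + ereal r1 * s"
    have r: "0 < r" using assms by (simp add: r_def)
    show "ereal c \<le> a + ereal r * s"
    proof (cases s)
      case (real t)
      have t: "\<delta> \<le> t" using s real by simp
      have "c - m' = (c - m') / \<delta> * \<delta>" using assms by simp
      also have "\<dots> \<le> (r - r1) * \<delta>" using assms by (intro mult_right_mono) (auto simp: r_def)
      also have "\<dots> \<le> (r - r1) * t" using t by (intro mult_left_mono) (auto simp: r_def)
      finally have "c \<le> m' + (r - r1) * t" by simp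
      with a real m show ?thesis by (cases a) (auto simp: algebra_simps)
    qed (use s r in auto)
  qed
qed

text \<open>Near \<open>p = 0\<close>, semicontinuity and continuity of the coupling give the bound
  without any penalty. Away from \<open>0\<close> the valley bounds \<open>\<sigma>\<close> below by
  a positive constant, and the value at \<open>r1\<close> is a finite floor from which a larger
  \<open>r\<close> lifts the term above \<open>c\<close>.\<close>

lemma augmented_Lagrangian_eventually_ge:
  fixes \<Phi> :: "'x::topological_space \<Rightarrow> 'p::real_topological_vector \<Rightarrow> ereal"
  assumes lsc: "lsc_at_within (\<lambda>(x, p). \<Phi> x p) (x, 0) UNIV"
    and cont: "(cpl \<mu> \<longlongrightarrow> 0) (at 0)" and zero: "cpl \<mu> 0 = 0"
    and nonneg: "\<And>p. 0 \<le> \<sigma> p" and valley: "valley_at_zero \<sigma>"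
    and r1: "0 \<le> r1" "augmented_Lagrangian \<Phi> cpl \<sigma> x \<mu> r1 \<noteq> -\<infinity>"
    and c: "ereal c < \<Phi> x 0"
  obtains r where "r1 \<le> r" "ereal c \<le> augmented_Lagrangian \<Phi> cpl \<sigma> x \<mu> r"
proof (cases "augmented_Lagrangian \<Phi> cpl \<sigma> x \<mu> r1 = \<infinity>")
  case True
  then show ?thesis using that[of r1] by simp
next
  case False
  \<comment> \<open>The gap \<open>c' - c\<close> is the room left for the coupling term.\<close>
  obtain c' where c': "c < c'" "ereal c' < \<Phi> x 0"
    using ereal_dense2[OF c] by auto
  obtain W where W: "open W" "(x, 0) \<in> W" "\<forall>z\<in>W. ereal c' < (case z of (y, p) \<Rightarrow> \<Phi> y p)"
    using lsc[unfolded lsc_at_within_def, rule_format, of "ereal c'"] c'(2) by auto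
  obtain X0 U where U: "open U" "0 \<in> U" "x \<in> X0" "X0 \<times> U \<subseteq> W"
    using W(1,2) by (auto elim: open_prod_elim)
  have "eventually (\<lambda>p. cpl \<mu> p < c' - c) (at 0)"
    using cont c'(1) by (intro order_tendstoD) auto
  then have "eventually (\<lambda>p. cpl \<mu> p < c' - c) (nhds 0)"
    using zero c'(1) by (auto simp: eventually_nhds_conv_at)
  then obtain V where V: "open V" "0 \<in> V" "\<And>p. p \<in> V \<Longrightarrow> cpl \<mu> p < c' - c"
    by (auto simp: eventually_nhds)
  obtain \<delta> where \<delta>: "0 < \<delta>" "\<And>p. p \<notin> U \<inter> V \<Longrightarrow> ereal \<delta> \<le> \<sigma> p"
    using valley U V unfolding valley_at_zero_def by (metis Int_iff open_Int)
  obtain r where r: "r1 \<le> r"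
    "\<And>a s. ereal \<delta> \<le> s \<Longrightarrow> augmented_Lagrangian \<Phi> cpl \<sigma> x \<mu> r1 \<le> a + ereal r1 * s
      \<Longrightarrow> ereal c \<le> a + ereal r * s"
    using penalized_term_eventually_ge[of \<delta> "augmented_Lagrangian \<Phi> cpl \<sigma> x \<mu> r1" r1 c]
      \<delta>(1) r1 False by auto
  have "ereal c \<le> \<Phi> x p - ereal (cpl \<mu> p) + ereal r * \<sigma> p" for p
  proof (cases "p \<in> U \<inter> V")
    case True
    then have "ereal c' < \<Phi> x p" "cpl \<mu> p < c' - c"
      using U W V by auto
    then have "ereal c \<le> \<Phi> x p - ereal (cpl \<mu> p)"
      by (cases "\<Phi> x p") auto
    also have "\<dots> \<le> \<Phi> x p - ereal (cpl \<mu> p) + ereal r * \<sigma> p"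
      using nonneg r r1 by (intro ereal_le_add_self) auto
    finally show ?thesis .
  next
    \<comment> \<open>The term at \<open>p\<close> with penalty \<open>r1\<close> dominates its
      infimum, which is the floor that \<open>r(2)\<close> asks for.\<close>
    case False
    then show ?thesis
      by (intro r(2) \<delta>(2)) (auto simp: augmented_Lagrangian_def intro: INF_lower)
  qed
  then have "ereal c \<le> augmented_Lagrangian \<Phi> cpl \<sigma> x \<mu> r"
    unfolding augmented_Lagrangian_def by (intro INF_greatest)
  with r(1) show ?thesis by (rule that)
qed

lemma compact_eventually_uniform:
  fixes Q :: "real \<Rightarrow> 'a::topological_space \<Rightarrow> bool"
  assumes "compact A" and mono: "\<And>r r' y. Q r y \<Longrightarrow> r \<le> r' \<Longrightarrow> Q r' y"
    and loc: "\<And>x. x \<in> A \<Longrightarrow> \<exists>r U. open U \<and> x \<in> U \<and> (\<forall>y\<in>U \<inter> A. Q r y)"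
  obtains r where "0 \<le> r" "\<forall>y\<in>A. Q r y"
proof -
  obtain R U where RU: "\<And>x. x \<in> A \<Longrightarrow> open (U x) \<and> x \<in> U x \<and> (\<forall>y\<in>U x \<inter> A. Q (R x) y)"
    using loc by metis
  obtain D where D: "D \<subseteq> A" "finite D" "A \<subseteq> (\<Union>x\<in>D. U x)"
    using RU by (auto intro: compactE_image[OF \<open>compact A\<close>, of A U])
  show thesis
  \<comment> \<open>Inserting \<open>0\<close> makes the maximum nonnegative and defined also for
    empty \<open>D\<close>.\<close>
  proof (rule that[of "Max (insert 0 (R ` D))"])
    show "\<forall>y\<in>A. Q (Max (insert 0 (R ` D))) y"
    proof
      fix y assume "y \<in> A"
      then obtain x where x: "x \<in> D" "y \<in> U x" using D by auto
      then have "Q (R x) y" using RU D \<open>y \<in> A\<close> by auto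
      then show "Q (Max (insert 0 (R ` D))) y"
        by (rule mono) (use x D in auto)
    qed
  qed (use D in auto)
qed

text \<open>\<open>L_proper\<close> excludes points of \<open>A\<close> where the augmented
  Lagrangian is \<open>-\<infinity>\<close> for every \<open>r\<close>. Such a point would violate
  the global bound for all \<open>r\<close>, while the local multiplier condition only controls
  neighbourhoods of optimal points.\<close>

theorem theorem1:
  fixes A :: "'x::topological_space set"
    and f :: "'x \<Rightarrow> ereal"
    and \<Phi> :: "'x \<Rightarrow> 'p::real_topological_vector \<Rightarrow> ereal"
    and cpl :: "'l::real_vector \<Rightarrow> 'p \<Rightarrow> real"
    and \<sigma> :: "'p \<Rightarrow> ereal"
  assumes A_nonempty: "A \<noteq> {}"
    and f_range: "\<forall>x. f x \<noteq> -\<infinity>"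
    and dom_nonempty: "{x \<in> A. f x < \<infinity>} \<noteq> {}"
    and opt_finite: "\<bar>INF x\<in>A. f x\<bar> \<noteq> \<infinity>"
    and cpl_bilinear: "bilinear cpl"
    and Phi_param: "dualizing_parameterization f \<Phi>"
    and sigma_aug: "augmenting_function \<sigma>"
    and A_compact: "compact A"
    and Phi_lsc: "\<forall>z\<in>A \<times> {0}. lsc_at_within (\<lambda>(x, p). \<Phi> x p) z UNIV"
    and cpl_cont: "\<forall>\<mu>. (cpl \<mu> \<longlongrightarrow> cpl \<mu> 0) (at 0)"
    and sigma_valley: "valley_at_zero \<sigma>"
    and L_lsc: "\<forall>\<mu>\<in>local_augmented_multipliers A f \<Phi> cpl \<sigma>. \<exists>r0\<ge>0. \<forall>r\<ge>r0. \<forall>x\<in>A.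
        lsc_at_within (\<lambda>y. augmented_Lagrangian \<Phi> cpl \<sigma> y \<mu> r) x A"
    and L_proper: "\<forall>\<mu>\<in>local_augmented_multipliers A f \<Phi> cpl \<sigma>. \<forall>x\<in>A. \<exists>r\<ge>0.
        augmented_Lagrangian \<Phi> cpl \<sigma> x \<mu> r \<noteq> -\<infinity>"
  shows "augmented_multipliers A \<Phi> cpl \<sigma> = local_augmented_multipliers A f \<Phi> cpl \<sigma>"
proof -
  define v where "v = (INF x\<in>A. f x)"
  define L where "L = augmented_Lagrangian \<Phi> cpl \<sigma>"
  have \<Phi>0: "\<Phi> x 0 = f x" for x
    using Phi_param by (simp add: dualizing_parameterization_def)
  have v_eq: "optimal_value_function A \<Phi> 0 = v"
    by (simp add: optimal_value_function_def v_def \<Phi>0)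
  have v_fin: "\<bar>v\<bar> \<noteq> \<infinity>"
    using opt_finite by (simp add: v_def)
  have v_le: "v \<le> f x" if "x \<in> A" for x
    using that by (auto simp: v_def intro: INF_lower)
  have v_min: "global_minimizer_on f A x \<longleftrightarrow> x \<in> A \<and> f x = v" for x
  proof
    assume "global_minimizer_on f A x"
    then show "x \<in> A \<and> f x = v"
      unfolding global_minimizer_on_def v_def by (auto intro: antisym INF_lower INF_greatest)
  qed (use v_le in \<open>auto simp: global_minimizer_on_def\<close>)
  have nonneg: "0 \<le> \<sigma> p" for p
    using sigma_aug by (rule augmenting_function_nonneg)
  have mono: "L x \<mu> r \<le> L x \<mu> r'" if "r \<le> r'" for x \<mu> r r'
    using that nonneg unfolding L_def by (intro augmented_Lagrangian_mono)
  have glob: "\<mu> \<in> augmented_multipliers A \<Phi> cpl \<sigma> \<longleftrightarrow> (\<exists>r\<ge>0. \<forall>x\<in>A. v \<le> L x \<mu> r)" for \<mu>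
    using augmented_multipliers_iff[OF nonneg, of A \<Phi>] v_fin by (simp add: v_eq L_def)
  have cpl0: "cpl \<mu> 0 = 0" for \<mu>
    using cpl_bilinear by (rule bilinear_rzero)
  show ?thesis
  proof (intro subset_antisym subsetI)
    fix \<mu> assume "\<mu> \<in> augmented_multipliers A \<Phi> cpl \<sigma>"
    then obtain r0 where r0: "0 \<le> r0" "\<And>x. x \<in> A \<Longrightarrow> v \<le> L x \<mu> r0"
      using glob by blast
    \<comment> \<open>For \<open>r \<ge> r0\<close> the value of \<open>L\<close> at
      \<open>xs\<close> is squeezed to \<open>v\<close>, so \<open>xs\<close> minimizes
      \<open>L\<close> on all of \<open>A\<close>.\<close>
    have "\<mu> \<in> augmented_multipliers_at A f \<Phi> cpl \<sigma> xs" if xs: "xs \<in> A" "f xs = v" for xs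
    proof -
      have "local_minimizer_on (\<lambda>x. L x \<mu> r) A xs \<and> L xs \<mu> r = f xs" if "r0 \<le> r" for r
      proof -
        have ge: "v \<le> L x \<mu> r" if "x \<in> A" for x
          using r0(2)[OF that] mono[OF \<open>r0 \<le> r\<close>] by (rule order_trans)
        have "L xs \<mu> r \<le> v"
          using augmented_Lagrangian_le[of cpl \<sigma> \<Phi> xs \<mu> r] cpl_bilinear sigma_aug xs
          by (simp add: L_def \<Phi>0 augmenting_function_def)
        with ge xs have "L xs \<mu> r = v" by (simp add: antisym)
        with ge xs show ?thesis
          unfolding local_minimizer_on_def by auto
      qed
      with r0(1) show ?thesis
        unfolding augmented_multipliers_at_def L_def by blast
    qed
    then show "\<mu> \<in> local_augmented_multipliers A f \<Phi> cpl \<sigma>"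
      by (auto simp: local_augmented_multipliers_def v_min)
  next
    fix \<mu> assume \<mu>: "\<mu> \<in> local_augmented_multipliers A f \<Phi> cpl \<sigma>"
    obtain r0 where r0: "0 \<le> r0" "\<And>r x. r0 \<le> r \<Longrightarrow> x \<in> A \<Longrightarrow> lsc_at_within (\<lambda>y. L y \<mu> r) x A"
      using L_lsc \<mu> unfolding L_def by blast
    have "\<exists>r U. open U \<and> x \<in> U \<and> (\<forall>y\<in>U \<inter> A. v \<le> L y \<mu> r)" if x: "x \<in> A" for x
    proof (cases "f x = v")
      case True
      then have "\<mu> \<in> augmented_multipliers_at A f \<Phi> cpl \<sigma> x"
        using \<mu> x by (auto simp: local_augmented_multipliers_def v_min)
      then obtain r where "local_minimizer_on (\<lambda>x. L x \<mu> r) A x" "L x \<mu> r = f x"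
        unfolding augmented_multipliers_at_def L_def by blast
      with True show ?thesis
        unfolding local_minimizer_on_def by auto
    next
      case False
      with v_le[OF x] have "v < f x" by simp
      \<comment> \<open>A level strictly above \<open>v\<close> yields the strict inequality that
        lower semicontinuity can spread.\<close>
      then obtain c where c: "v < ereal c" "ereal c < f x"
        using ereal_dense2 by blast
      obtain r2 where r2: "0 \<le> r2" "L x \<mu> r2 \<noteq> -\<infinity>"
        using L_proper \<mu> x unfolding L_def by blast
      \<comment> \<open>Starting from \<open>max r0 r2\<close> keeps the final \<open>r\<close> in
        the range where \<open>L\<close> is lower semicontinuous.\<close>
      have "L x \<mu> (max r0 r2) \<noteq> -\<infinity>"
        using mono[of r2 "max r0 r2" x \<mu>] r2(2) by auto
      then obtain r where r: "max r0 r2 \<le> r" "ereal c \<le> L x \<mu> r"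
        unfolding L_def
        using augmented_Lagrangian_eventually_ge[of \<Phi> x cpl \<mu> \<sigma> "max r0 r2" c thesis]
          Phi_lsc x cpl_cont[rule_format, of \<mu>] cpl0[of \<mu>] nonneg sigma_valley r0(1) c(2) \<Phi>0[of x]
        by (simp add: max.coboundedI1)
      have "v < L x \<mu> r" using c(1) r(2) by (rule less_le_trans)
      moreover have "lsc_at_within (\<lambda>y. L y \<mu> r) x A"
        using r0(2) r(1) x by simp
      ultimately obtain U where "open U" "x \<in> U" "\<forall>y\<in>U \<inter> A. v < L y \<mu> r"
        unfolding lsc_at_within_def by blast
      then show ?thesis by (meson less_imp_le)
    qed
    then obtain r where "0 \<le> r" "\<forall>x\<in>A. v \<le> L x \<mu> r"
      using compact_eventually_uniform[OF A_compact, of "\<lambda>r x. v \<le> L x \<mu> r"]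
        order_trans[OF _ mono] by blast
    then show "\<mu> \<in> augmented_multipliers A \<Phi> cpl \<sigma>"
      using glob by blast
  qed
qed

end
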